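(* For all integers $N,k,n\geqslant 0$, $$p(N,k,n) = \sum_{j=0}^{\lfloor k/2 \rfloor} \overline{p}_2\Bigg( N,\;N+1-k+2j,\;j,\;k-2j,\;n-\binom{k-2j}{2}\Bigg).$$
   Context: For integers $N,k,n\geqslant 0$, $p(N,k,n)$ denotes the number of partitions of $n$ into at most $k$ parts, each part less than or equal to $N$ (the empty partition is the unique partition of $0$). Assume there are positive integers of two kinds, $\lambda$ (first kind) and $\overline{\lambda}$ (second kind). For an integer $r\geqslant 1$ and integers $N_1,N_2,k_1,k_2,n\geqslant 0$, $\overline{p}_r(N_1,N_2,k_1,k_2,n)$ denotes the number of partitions of $n$ into parts of two kinds with at most $k_1$ parts of the first kind, each divisible by $r$ and less than or equal to $N_1r$, and at most $k_2$ parts of the second kind, each less than or equal to $N_2$ (the order of the parts is irrelevant). For example $\overline{p}_2(2,3,2,2,4)=6$, the partitions being $4$, $2+2$, $2+\overline{2}$, $2+\overline{1}+\overline{1}$, $\overline{3}+\overline{1}$, $\overline{2}+\overline{2}$. Convention: $\overline{p}_r(N_1,N_2,k_1,k_2,n)=0$ whenever any of $N_1,N_2,k_1,k_2,n$ is negative. Also $\binom{m}{2}=m(m-1)/2$. *)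

theory Defs
  imports Complex_Main "HOL-Library.Multiset"
begin

definition partitions :: "nat \<Rightarrow> nat \<Rightarrow> nat \<Rightarrow> nat multiset set" where
  "partitions N k n =
     {M. size M \<le> k \<and> (\<forall>x \<in># M. 1 \<le> x \<and> x \<le> N) \<and> sum_mset M = n}"

definition p :: "nat \<Rightarrow> nat \<Rightarrow> nat \<Rightarrow> nat" where
  "p N k n = card (partitions N k n)"

datatype part = is_first: First (part_size: nat) | is_second: Second (part_size: nat)

definition two_kind_partitions ::
  "nat \<Rightarrow> nat \<Rightarrow> nat \<Rightarrow> nat \<Rightarrow> nat \<Rightarrow> nat \<Rightarrow> part multiset set" where
  "two_kind_partitions r N1 N2 k1 k2 n =
     {M. size (filter_mset is_first M) \<le> k1 \<and>
         size (filter_mset is_second M) \<le> k2 \<and>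
         (\<forall>x. First x \<in># M \<longrightarrow> 1 \<le> x \<and> r dvd x \<and> x \<le> N1 * r) \<and>
         (\<forall>x. Second x \<in># M \<longrightarrow> 1 \<le> x \<and> x \<le> N2) \<and>
         sum_mset (image_mset part_size M) = n}"

text \<open>The arguments other than \<open>r\<close> are integers, so that the convention that the count
  vanishes when one of them is negative can be expressed; \<open>r\<close> is meant to be positive.\<close>

definition pbar :: "nat \<Rightarrow> int \<Rightarrow> int \<Rightarrow> int \<Rightarrow> int \<Rightarrow> int \<Rightarrow> nat" where
  "pbar r N1 N2 k1 k2 n =
     (if N1 < 0 \<or> N2 < 0 \<or> k1 < 0 \<or> k2 < 0 \<or> n < 0 then 0
      else card (two_kind_partitions r (nat N1) (nat N2) (nat k1) (nat k2) (nat n)))"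

end

theory Submission
  imports Defs
begin

text \<open>Padding with zeros turns a partition with at most \<open>k\<close> parts into a multiset of exactly \<open>k\<close>
  elements of \<open>{..N}\<close>. Such a multiset is uniquely \<open>A + A + D\<close> with \<open>D\<close> a set, namely the
  elements of odd multiplicity. If \<open>size A = j\<close>, then \<open>A + A\<close> contributes \<open>j\<close> parts
  of the first kind (twice the elements of \<open>A\<close>), and \<open>D\<close> has \<open>m = k - 2 * j\<close> elements. Subtracting the staircase
  \<open>0, 1, \<dots>, m - 1\<close>, whose sum is \<open>m choose 2\<close>, from the increasing enumeration of \<open>D\<close> leaves an arbitrary
  multiset of \<open>m\<close> elements of \<open>{..N + 1 - m}\<close>, which are the parts of the second kind.\<close>

section \<open>Padding with zeros\<close>

definition bounded_msets :: "nat \<Rightarrow> nat \<Rightarrow> nat multiset set" where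
  "bounded_msets N k = {M. size M = k \<and> set_mset M \<subseteq> {..N}}"

abbreviation nonzero_mset :: "nat multiset \<Rightarrow> nat multiset" where
  "nonzero_mset \<equiv> filter_mset ((<) 0)"

lemma nonzero_mset_plus_zeros:
  "nonzero_mset M + replicate_mset (size M - size (nonzero_mset M)) 0 = M"
proof -
  have M: "M = nonzero_mset M + filter_mset (\<lambda>x. \<not> 0 < x) M"
    by (rule multiset_partition)
  have z: "filter_mset (\<lambda>x. \<not> 0 < x) M = replicate_mset (count M 0) 0"
    using filter_eq_replicate_mset[of 0 M] by (simp add: eq_commute)
  have "size M = size (nonzero_mset M) + count M 0"
    by (metis M z size_union size_replicate_mset)
  then show ?thesis
    using M z by (metis add_diff_cancel_left')
qed

text \<open>Only zeros are discarded, and the common size determines how many, so they can be put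
  back.\<close>

lemma nonzero_mset_inj:
  "size A = size B \<Longrightarrow> nonzero_mset A = nonzero_mset B \<Longrightarrow> A = B"
  by (metis nonzero_mset_plus_zeros)

lemma nonzero_mset_add_zeros:
  "\<forall>x\<in>#P. 1 \<le> x \<Longrightarrow> nonzero_mset (P + replicate_mset l 0) = P"
  by (induction l) (auto simp: filter_mset_eq_conv)

lemma sum_mset_nonzero: "sum_mset (nonzero_mset M) = sum_mset M"
  by (induction M) auto

text \<open>Zeros fill the places left free by \<open>P\<close>. This gives surjectivity for
  ordinary partitions, and later for each of the two kinds separately.\<close>

lemma obtain_padded:
  assumes "size P \<le> k" "\<forall>x\<in>#P. 1 \<le> x \<and> x \<le> N"
  obtains M where "M \<in> bounded_msets N k" "nonzero_mset M = P"
proof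
  let ?M = "P + replicate_mset (k - size P) 0"
  show "?M \<in> bounded_msets N k"
    using assms by (auto simp: bounded_msets_def)
  show "nonzero_mset ?M = P"
    using assms by (intro nonzero_mset_add_zeros) auto
qed

lemma finite_bounded_msets: "finite (bounded_msets N k)"
proof -
  have "bounded_msets N k \<subseteq> mset ` {xs. set xs \<subseteq> {..N} \<and> length xs = k}"
  proof
    fix M assume "M \<in> bounded_msets N k"
    then obtain xs where "mset xs = M" "size M = k" "set_mset M \<subseteq> {..N}"
      using ex_mset[of M] by (auto simp: bounded_msets_def)
    then show "M \<in> mset ` {xs. set xs \<subseteq> {..N} \<and> length xs = k}"
      by (intro image_eqI[of _ _ xs]) auto
  qed
  then show ?thesis
    by (rule finite_subset) (simp add: finite_lists_length_eq)
qed

lemma bij_betw_partitions: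
  "bij_betw nonzero_mset {M \<in> bounded_msets N k. sum_mset M = n} (partitions N k n)"
  unfolding bij_betw_def
proof
  show "inj_on nonzero_mset {M \<in> bounded_msets N k. sum_mset M = n}"
    by (auto intro!: inj_onI nonzero_mset_inj simp: bounded_msets_def)
  show "nonzero_mset ` {M \<in> bounded_msets N k. sum_mset M = n} = partitions N k n"
  proof (intro equalityI subsetI)
    fix P assume "P \<in> nonzero_mset ` {M \<in> bounded_msets N k. sum_mset M = n}"
    then show "P \<in> partitions N k n"
      by (auto simp: partitions_def bounded_msets_def sum_mset_nonzero Suc_le_eq
          intro: size_filter_mset_lesseq)
  next
    fix P assume P: "P \<in> partitions N k n"
    then obtain M where "M \<in> bounded_msets N k" "nonzero_mset M = P"
      using obtain_padded[of P k N] by (auto simp: partitions_def)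
    then show "P \<in> nonzero_mset ` {M \<in> bounded_msets N k. sum_mset M = n}"
      using P sum_mset_nonzero[of M] by (auto simp: partitions_def)
  qed
qed

section \<open>Splitting multiplicities by parity\<close>

definition double_plus_set :: "nat multiset \<times> nat set \<Rightarrow> nat multiset" where
  "double_plus_set = (\<lambda>(A, D). A + A + mset_set D)"

definition mset_set_pairs :: "nat \<Rightarrow> nat \<Rightarrow> nat \<Rightarrow> nat \<Rightarrow> (nat multiset \<times> nat set) set" where
  "mset_set_pairs N j m n =
     {(A, D). A \<in> bounded_msets N j \<and> D \<subseteq> {..N} \<and> card D = m \<and> 2 * sum_mset A + \<Sum>D = n}"

lemma finite_mset_set_pairs: "finite (mset_set_pairs N j m n)"
  by (rule finite_subset[of _ "bounded_msets N j \<times> Pow {..N}"])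
    (auto simp: mset_set_pairs_def finite_bounded_msets)

text \<open>The multiplicity of \<open>x\<close> in the image is twice that in \<open>A\<close>,
  plus one exactly if \<open>x\<close> lies in \<open>D\<close>. Its parity recovers
  \<open>D\<close>, and its quotient by 2 then recovers \<open>A\<close>.\<close>

lemma double_plus_set_inj:
  assumes "finite D" "finite D'" "double_plus_set (A, D) = double_plus_set (A', D')"
  shows "A = A' \<and> D = D'"
proof -
  have c: "2 * count A x + of_bool (x \<in> D) = 2 * count A' x + of_bool (x \<in> D')" for x
    using arg_cong[OF assms(3), of "\<lambda>M. count M x"] assms(1,2)
    by (cases "x \<in> D"; cases "x \<in> D'") (auto simp: double_plus_set_def)
  have odd_iff: "x \<in> D \<longleftrightarrow> x \<in> D'" for x
    using arg_cong[OF c[of x], of odd] by simp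
  have "count A x = count A' x" for x
    using c[of x] odd_iff[of x] by simp
  then show ?thesis
    using odd_iff by (auto intro: multiset_eqI)
qed

lemma obtain_double_plus_set:
  obtains A D where "finite D" "D \<subseteq> set_mset M" "set_mset A \<subseteq> set_mset M" "M = double_plus_set (A, D)"
proof
  let ?D = "{x \<in> set_mset M. odd (count M x)}"
  let ?A = "Abs_multiset (\<lambda>x. count M x div 2)"
  \<comment> \<open>The halved multiplicities must have finite support for
    \<open>Abs_multiset\<close> to yield a multiset with these counts.\<close>
  have "finite {x. 0 < count M x div 2}"
    by (rule finite_subset[OF _ finite_set_mset[of M]]) (auto simp: count_greater_zero_iff[symmetric] simp del: count_greater_zero_iff)
  then have cA: "count ?A = (\<lambda>x. count M x div 2)"
    by simp
  show "finite ?D" "?D \<subseteq> set_mset M" by auto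
  show "set_mset ?A \<subseteq> set_mset M"
  proof
    fix x assume "x \<in># ?A"
    then have "0 < count ?A x" by simp
    then have "0 < count M x" unfolding cA by linarith
    then show "x \<in># M" by simp
  qed
  show "M = double_plus_set (?A, ?D)"
  proof (rule multiset_eqI)
    fix x
    show "count M x = count (double_plus_set (?A, ?D)) x"
    proof (cases "odd (count M x)")
      case True
      then have "x \<in> ?D"
        by (metis (mono_tags, lifting) count_eq_zero_iff even_zero mem_Collect_eq)
      then show ?thesis
        using True cA unfolding double_plus_set_def by simp presburger
    next
      case False
      then have "x \<notin> ?D" by simp
      then show ?thesis
        using False cA unfolding double_plus_set_def by simp presburger
    qed
  qed
qed

text \<open>Comparing sizes gives \<open>k = 2 * size A + card D\<close>, so the index
  \<open>j\<close> of the union is forced to be \<open>size A\<close>, and it ranges up to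
  \<open>k div 2\<close>.\<close>

lemma bij_betw_double_plus_set:
  "bij_betw double_plus_set (\<Union>j\<in>{0..k div 2}. mset_set_pairs N j (k - 2 * j) n)
     {M \<in> bounded_msets N k. sum_mset M = n}"
  unfolding bij_betw_def
proof
  have fin: "D \<subseteq> {..N} \<Longrightarrow> finite D" for D :: "nat set"
    by (rule finite_subset) auto
  show "inj_on double_plus_set (\<Union>j\<in>{0..k div 2}. mset_set_pairs N j (k - 2 * j) n)"
    using fin by (auto simp: mset_set_pairs_def intro!: inj_onI dest: double_plus_set_inj[rotated 2])
  show "double_plus_set ` (\<Union>j\<in>{0..k div 2}. mset_set_pairs N j (k - 2 * j) n) =
      {M \<in> bounded_msets N k. sum_mset M = n}"
  proof (intro equalityI subsetI)
    fix M assume "M \<in> double_plus_set ` (\<Union>j\<in>{0..k div 2}. mset_set_pairs N j (k - 2 * j) n)"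
    then obtain j A D where *: "j \<le> k div 2" "(A, D) \<in> mset_set_pairs N j (k - 2 * j) n"
      "M = double_plus_set (A, D)"
      by auto
    then have "finite D"
      using fin by (auto simp: mset_set_pairs_def)
    with * show "M \<in> {M \<in> bounded_msets N k. sum_mset M = n}"
      by (auto simp: mset_set_pairs_def double_plus_set_def bounded_msets_def sum_unfold_sum_mset)
  next
    fix M assume M: "M \<in> {M \<in> bounded_msets N k. sum_mset M = n}"
    obtain A D where *: "finite D" "D \<subseteq> set_mset M" "set_mset A \<subseteq> set_mset M"
      "M = double_plus_set (A, D)"
      by (rule obtain_double_plus_set)
    then have "k = 2 * size A + card D"
      using M by (auto simp: bounded_msets_def double_plus_set_def)
    moreover from this have "size A \<le> k div 2" by simp
    ultimately have "(A, D) \<in> (\<Union>j\<in>{0..k div 2}. mset_set_pairs N j (k - 2 * j) n)"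
      using M * by (auto simp: mset_set_pairs_def bounded_msets_def double_plus_set_def
          sum_unfold_sum_mset intro!: bexI[of _ "size A"])
    then show "M \<in> double_plus_set ` (\<Union>j\<in>{0..k div 2}. mset_set_pairs N j (k - 2 * j) n)"
      using *(4) by blast
  qed
qed

lemma p_eq_sum_mset_set_pairs:
  "p N k n = (\<Sum>j = 0..k div 2. card (mset_set_pairs N j (k - 2 * j) n))"
proof -
  have "p N k n = card {M \<in> bounded_msets N k. sum_mset M = n}"
    unfolding p_def using bij_betw_same_card[OF bij_betw_partitions] by simp
  also have "\<dots> = card (\<Union>j\<in>{0..k div 2}. mset_set_pairs N j (k - 2 * j) n)"
    using bij_betw_same_card[OF bij_betw_double_plus_set] by simp
  also have "\<dots> = (\<Sum>j = 0..k div 2. card (mset_set_pairs N j (k - 2 * j) n))"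
    \<comment> \<open>The union is disjoint because \<open>j\<close> is the size of the first
      component.\<close>
    by (rule card_UN_disjoint) (auto simp: finite_mset_set_pairs, auto simp: mset_set_pairs_def bounded_msets_def)
  finally show ?thesis .
qed

section \<open>Adding and removing a staircase\<close>

definition add_staircase_list :: "nat list \<Rightarrow> nat list" where
  "add_staircase_list xs = map (\<lambda>i. xs ! i + i) [0..<length xs]"

text \<open>Indices start at 0, so the smallest element is unchanged and the total increase is
  \<open>size B choose 2\<close>.\<close>

definition add_staircase :: "nat multiset \<Rightarrow> nat set" where
  "add_staircase B = set (add_staircase_list (sorted_list_of_multiset B))"

lemma sorted_wrt_add_staircase_list:
  "sorted xs \<Longrightarrow> sorted_wrt (<) (add_staircase_list xs)"
  by (auto simp: add_staircase_list_def sorted_wrt_iff_nth_less sorted_iff_nth_mono_less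
      intro!: add_le_less_mono)

text \<open>A strictly increasing list is the sorted enumeration of its own set. Passing to the set
  therefore loses nothing, and injectivity and cardinality can be read off the list.\<close>

lemma sorted_list_of_add_staircase:
  "sorted_list_of_set (add_staircase B) = add_staircase_list (sorted_list_of_multiset B)"
  unfolding add_staircase_def
  using strict_sorted_equal[OF sorted_wrt_add_staircase_list[of "sorted_list_of_multiset B"]]
  by (simp add: sorted_sorted_list_of_multiset)

lemma length_sorted_list_of_multiset: "length (sorted_list_of_multiset B) = size B"
  by (metis mset_sorted_list_of_multiset size_mset)

lemma add_staircase_list_inj:
  assumes "add_staircase_list xs = add_staircase_list ys"
  shows "xs = ys"
proof (rule nth_equalityI)
  show l: "length xs = length ys"
    using arg_cong[OF assms, of length] by (simp add: add_staircase_list_def)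
  show "xs ! i = ys ! i" if "i < length xs" for i
    using arg_cong[OF assms, of "\<lambda>zs. zs ! i"] l that by (simp add: add_staircase_list_def)
qed

lemma add_staircase_inj: "add_staircase A = add_staircase B \<Longrightarrow> A = B"
  by (metis sorted_list_of_add_staircase add_staircase_list_inj mset_sorted_list_of_multiset)

lemma card_add_staircase: "card (add_staircase B) = size B"
  by (metis sorted_list_of_add_staircase length_sorted_list_of_multiset length_map length_upt
      add_staircase_list_def minus_nat.diff_0 length_sorted_list_of_set)

lemma sum_add_staircase: "\<Sum>(add_staircase B) = sum_mset B + (size B choose 2)"
proof -
  let ?xs = "sorted_list_of_multiset B"
  have "distinct (add_staircase_list ?xs)"
    by (metis sorted_list_of_add_staircase distinct_sorted_list_of_set)
  \<comment> \<open>Distinctness ensures that no summand is lost in the set. The list sum then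
    splits into the original entries and \<open>0 + 1 + ...\<close> up to
    \<open>size B - 1\<close>.\<close>
  then have "\<Sum>(add_staircase B) = sum_list (add_staircase_list ?xs)"
    unfolding add_staircase_def by (simp add: distinct_sum_list_conv_Sum)
  also have "\<dots> = sum_list (map (\<lambda>i. ?xs ! i) [0..<length ?xs]) + sum_list [0..<length ?xs]"
    unfolding add_staircase_list_def by (simp add: sum_list_addf)
  also have "sum_list (map (\<lambda>i. ?xs ! i) [0..<length ?xs]) = sum_mset B"
    by (metis map_nth mset_sorted_list_of_multiset sum_mset_sum_list)
  also have "sum_list [0..<length ?xs] = size B choose 2"
    by (simp add: length_sorted_list_of_multiset choose_two Sum_Ico_nat sum_list_distinct_conv_sum_set)
  finally show ?thesis .
qed

text \<open>Strictly increasing naturals grow by at least 1 at each step. This makes the entries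
  stay weakly increasing when the staircase is removed.\<close>

lemma strict_sorted_nth_diff:
  fixes ys :: "nat list"
  assumes "sorted_wrt (<) ys" "i + d < length ys"
  shows "ys ! i + d \<le> ys ! (i + d)"
  using assms(2)
proof (induction d)
  case (Suc d)
  have "ys ! (i + d) < ys ! (i + Suc d)"
    using assms(1) Suc.prems by (auto simp: sorted_wrt_iff_nth_less)
  with Suc show ?case by simp
qed simp

text \<open>An entry is at most \<open>L\<close> and is raised by at most \<open>m - 1\<close>,
  hence the strict bound \<open>L + m\<close>. Conversely, the staircase is subtracted from the
  increasing enumeration of \<open>D\<close>.\<close>

lemma bij_betw_add_staircase:
  "bij_betw add_staircase (bounded_msets L m) {D. D \<subseteq> {..<L + m} \<and> card D = m}"
  unfolding bij_betw_def
proof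
  show "inj_on add_staircase (bounded_msets L m)"
    by (auto intro: inj_onI add_staircase_inj)
  show "add_staircase ` bounded_msets L m = {D. D \<subseteq> {..<L + m} \<and> card D = m}"
  proof (intro equalityI subsetI)
    fix D assume "D \<in> add_staircase ` bounded_msets L m"
    then obtain B where B: "size B = m" "set_mset B \<subseteq> {..L}" "D = add_staircase B"
      by (auto simp: bounded_msets_def)
    have "D \<subseteq> {..<L + m}"
    proof
      fix x assume "x \<in> D"
      then obtain i where i: "i < m" "x = sorted_list_of_multiset B ! i + i"
        using B by (auto simp: add_staircase_def add_staircase_list_def length_sorted_list_of_multiset)
      then have "sorted_list_of_multiset B ! i \<in># B"
        using B(1) by (metis length_sorted_list_of_multiset nth_mem set_sorted_list_of_multiset)
      then show "x \<in> {..<L + m}"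
        using B(2) i by auto
    qed
    then show "D \<in> {D. D \<subseteq> {..<L + m} \<and> card D = m}"
      using B card_add_staircase by simp
  next
    fix D assume D: "D \<in> {D. D \<subseteq> {..<L + m} \<and> card D = m}"
    then have fin: "finite D"
      using finite_subset by blast
    define ys where "ys = sorted_list_of_set D"
    have ys: "sorted_wrt (<) ys" "length ys = m" "set ys = D"
      using D fin by (auto simp: ys_def)
    have diff: "ys ! i + (j - i) \<le> ys ! j" if "i \<le> j" "j < m" for i j
      using strict_sorted_nth_diff[OF ys(1), of i "j - i"] that ys(2) by simp
    \<comment> \<open>This keeps the subtraction \<open>ys ! i - i\<close> from being truncated, so
      that adding \<open>i\<close> back restores \<open>ys ! i\<close>.\<close>
    have ge: "i \<le> ys ! i" if "i < m" for i
      using diff[of 0 i] that by simp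
    have bound: "ys ! i < L + m" if "i < m" for i
      using D ys that nth_mem[of i ys] by auto
    define xs where "xs = map (\<lambda>i. ys ! i - i) [0..<m]"
    \<comment> \<open>Compare with the last entry: \<open>ys ! i + (m - 1 - i)\<close> is at most
      \<open>ys ! (m - 1)\<close>, which is below \<open>L + m\<close>.\<close>
    have xs_le: "ys ! i - i \<le> L" if "i < m" for i
      using diff[of i "m - 1"] bound[of "m - 1"] that by fastforce
    have "sorted xs"
      unfolding xs_def sorted_iff_nth_mono
    proof safe
      fix i j assume "i \<le> j" "j < length (map (\<lambda>i. ys ! i - i) [0..<m])"
      then show "map (\<lambda>i. ys ! i - i) [0..<m] ! i \<le> map (\<lambda>i. ys ! i - i) [0..<m] ! j"
        using diff[of i j] ge[of i] by simp
    qed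
    then have "sorted_list_of_multiset (mset xs) = xs"
      by (simp add: sorted_sort_id)
    moreover have "add_staircase_list xs = ys"
      using ge ys(2) by (intro nth_equalityI) (auto simp: add_staircase_list_def xs_def)
    ultimately have "add_staircase (mset xs) = D"
      using ys(3) by (simp add: add_staircase_def)
    moreover have "mset xs \<in> bounded_msets L m"
      using xs_le by (auto simp: bounded_msets_def xs_def)
    ultimately show "D \<in> add_staircase ` bounded_msets L m"
      by blast
  qed
qed

section \<open>From pairs of multisets to partitions of two kinds\<close>

definition mset_mset_pairs :: "nat \<Rightarrow> nat \<Rightarrow> nat \<Rightarrow> nat \<Rightarrow> nat \<Rightarrow> (nat multiset \<times> nat multiset) set" where
  "mset_mset_pairs N L j m n =
     {(A, B). A \<in> bounded_msets N j \<and> B \<in> bounded_msets L m \<and> 2 * sum_mset A + sum_mset B = n}"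

lemma bij_betw_pairs:
  assumes "L + m = N + 1"
  shows "bij_betw (map_prod id add_staircase) (mset_mset_pairs N L j m n)
    (mset_set_pairs N j m (n + (m choose 2)))"
  unfolding bij_betw_def
proof
  \<comment> \<open>Since \<open>L + m = N + 1\<close>, the range \<open>{..<L + m}\<close> is
    exactly \<open>{..N}\<close>. This is the source of the bound \<open>N + 1 - k + 2j\<close> on
    parts of the second kind.\<close>
  have img: "add_staircase ` bounded_msets L m = {D. D \<subseteq> {..N} \<and> card D = m}"
    using bij_betw_add_staircase[of L m] assms by (auto simp: bij_betw_def lessThan_Suc_atMost)
  show "inj_on (map_prod id add_staircase) (mset_mset_pairs N L j m n)"
    by (auto intro!: inj_onI dest: add_staircase_inj)
  show "map_prod id add_staircase ` mset_mset_pairs N L j m n = mset_set_pairs N j m (n + (m choose 2))"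
  proof (intro equalityI subsetI)
    fix x assume "x \<in> map_prod id add_staircase ` mset_mset_pairs N L j m n"
    then obtain A B where AB: "A \<in> bounded_msets N j" "B \<in> bounded_msets L m"
      "2 * sum_mset A + sum_mset B = n" "x = (A, add_staircase B)"
      by (auto simp: mset_mset_pairs_def)
    moreover have "add_staircase B \<in> {D. D \<subseteq> {..N} \<and> card D = m}"
      using img AB(2) by blast
    moreover have "size B = m"
      using AB(2) by (simp add: bounded_msets_def)
    ultimately show "x \<in> mset_set_pairs N j m (n + (m choose 2))"
      using sum_add_staircase[of B] by (auto simp: mset_set_pairs_def)
  next
    fix x assume "x \<in> mset_set_pairs N j m (n + (m choose 2))"
    then obtain A D where AD: "A \<in> bounded_msets N j" "D \<in> {D. D \<subseteq> {..N} \<and> card D = m}"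
      "2 * sum_mset A + \<Sum>D = n + (m choose 2)" "x = (A, D)"
      by (auto simp: mset_set_pairs_def)
    then obtain B where B: "B \<in> bounded_msets L m" "D = add_staircase B"
      using img by blast
    then have "size B = m"
      by (simp add: bounded_msets_def)
    then have "(A, B) \<in> mset_mset_pairs N L j m n"
      using AD B sum_add_staircase[of B] by (auto simp: mset_mset_pairs_def)
    then show "x \<in> map_prod id add_staircase ` mset_mset_pairs N L j m n"
      using AD B by (intro image_eqI[of _ _ "(A, B)"]) auto
  qed
qed

definition two_kind_of_pair :: "nat multiset \<times> nat multiset \<Rightarrow> part multiset" where
  "two_kind_of_pair = (\<lambda>(A, B). image_mset (\<lambda>x. First (2 * x)) (nonzero_mset A) +
     image_mset Second (nonzero_mset B))"

lemma filter_two_kind_of_pair: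
  "filter_mset is_first (two_kind_of_pair (A, B)) = image_mset (\<lambda>x. First (2 * x)) (nonzero_mset A)"
  "filter_mset is_second (two_kind_of_pair (A, B)) = image_mset Second (nonzero_mset B)"
  by (auto simp: two_kind_of_pair_def filter_mset_image_mset)

text \<open>The constructors keep the two kinds apart, so filtering by kind recovers both nonzero
  parts, and the prescribed sizes \<open>j\<close> and \<open>m\<close> recover the zeros. Dropping
  zeros turns these exact sizes into upper bounds on the numbers of parts.\<close>

lemma bij_betw_two_kind_of_pair:
  "bij_betw two_kind_of_pair (mset_mset_pairs N L j m n) (two_kind_partitions 2 N L j m n)"
  unfolding bij_betw_def
proof
  have inj: "inj (image_mset (\<lambda>x. First (2 * x)))" "inj (image_mset Second)"
    by (intro multiset.inj_map inj_onI; simp)+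
  show "inj_on two_kind_of_pair (mset_mset_pairs N L j m n)"
  proof (rule inj_onI)
    fix u v assume uv: "u \<in> mset_mset_pairs N L j m n" "v \<in> mset_mset_pairs N L j m n"
      and eq: "two_kind_of_pair u = two_kind_of_pair v"
    obtain A B A' B' where [simp]: "u = (A, B)" "v = (A', B')"
      by (cases u; cases v)
    have "nonzero_mset A = nonzero_mset A'" "nonzero_mset B = nonzero_mset B'"
      using arg_cong[OF eq, of "filter_mset is_first"] arg_cong[OF eq, of "filter_mset is_second"] inj
      by (auto simp: filter_two_kind_of_pair dest: injD)
    then show "u = v"
      using uv by (auto simp: mset_mset_pairs_def bounded_msets_def intro: nonzero_mset_inj)
  qed
  show "two_kind_of_pair ` mset_mset_pairs N L j m n = two_kind_partitions 2 N L j m n"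
  proof (intro equalityI subsetI)
    fix T assume "T \<in> two_kind_of_pair ` mset_mset_pairs N L j m n"
    then obtain A B where AB: "A \<in> bounded_msets N j" "B \<in> bounded_msets L m"
      "2 * sum_mset A + sum_mset B = n" and T: "T = two_kind_of_pair (A, B)"
      by (auto simp: mset_mset_pairs_def)
    have "sum_mset (image_mset part_size T) = 2 * sum_mset (nonzero_mset A) + sum_mset (nonzero_mset B)"
      unfolding T two_kind_of_pair_def
      by (simp add: image_mset.compositionality comp_def sum_mset_distrib_left[symmetric])
    then have "sum_mset (image_mset part_size T) = n"
      using AB(3) by (simp only: sum_mset_nonzero)
    moreover have "size (filter_mset is_first T) \<le> j" "size (filter_mset is_second T) \<le> m"
      using AB(1,2) size_filter_mset_lesseq
      unfolding T filter_two_kind_of_pair by (auto simp: bounded_msets_def)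
    moreover have "1 \<le> x \<and> 2 dvd x \<and> x \<le> N * 2" if "First x \<in># T" for x
      using that AB(1) unfolding T two_kind_of_pair_def by (auto simp: bounded_msets_def)
    moreover have "1 \<le> x \<and> x \<le> L" if "Second x \<in># T" for x
      using that AB(2) unfolding T two_kind_of_pair_def by (auto simp: bounded_msets_def)
    ultimately show "T \<in> two_kind_partitions 2 N L j m n"
      unfolding two_kind_partitions_def by blast
  next
    fix T assume T: "T \<in> two_kind_partitions 2 N L j m n"
    let ?F = "filter_mset is_first T" and ?S = "filter_mset is_second T"
    \<comment> \<open>Parts of the first kind are even and at most \<open>N * 2\<close>, so halving
      them is exact and lands in the range up to \<open>N\<close>.\<close>
    define P where "P = image_mset (\<lambda>x. part_size x div 2) ?F"
    define Q where "Q = image_mset part_size ?S"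
    have First: "1 \<le> x \<and> 2 dvd x \<and> x \<le> N * 2" if "First x \<in># T" for x
      using T that by (auto simp: two_kind_partitions_def)
    have Second: "1 \<le> x \<and> x \<le> L" if "Second x \<in># T" for x
      using T that by (auto simp: two_kind_partitions_def)
    have "size P \<le> j" "size Q \<le> m"
      using T by (auto simp: P_def Q_def two_kind_partitions_def)
    moreover have "\<forall>x\<in>#P. 1 \<le> x \<and> x \<le> N"
    proof
      fix x assume "x \<in># P"
      then obtain y where "First y \<in># T" "x = y div 2"
        unfolding P_def by (auto simp: is_first_def)
      then show "1 \<le> x \<and> x \<le> N"
        using First[of y] by auto
    qed
    moreover have "\<forall>x\<in>#Q. 1 \<le> x \<and> x \<le> L"
      using Second by (auto simp: Q_def is_second_def)
    ultimately obtain A B where AB: "A \<in> bounded_msets N j" "nonzero_mset A = P"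
      "B \<in> bounded_msets L m" "nonzero_mset B = Q"
      by (metis obtain_padded)
    have "image_mset (\<lambda>x. First (2 * x)) P = image_mset id ?F"
      unfolding P_def image_mset.compositionality
      using First by (intro image_mset_cong) (auto simp: is_first_def)
    moreover have "image_mset Second Q = image_mset id ?S"
      unfolding Q_def image_mset.compositionality
      by (intro image_mset_cong) (auto simp: is_second_def)
    moreover have "T = ?F + ?S"
    proof -
      have "is_second = (\<lambda>x. \<not> is_first x)"
        by (auto simp: fun_eq_iff is_first_def is_second_def intro: part.exhaust)
      then show ?thesis
        using multiset_partition[of T is_first] by simp
    qed
    ultimately have TAB: "T = two_kind_of_pair (A, B)"
      using AB by (simp add: two_kind_of_pair_def)
    have "sum_mset (image_mset part_size T) = 2 * sum_mset (nonzero_mset A) + sum_mset (nonzero_mset B)"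
      unfolding TAB two_kind_of_pair_def
      by (simp add: image_mset.compositionality comp_def sum_mset_distrib_left[symmetric])
    then have "2 * sum_mset A + sum_mset B = n"
      using T by (simp add: sum_mset_nonzero two_kind_partitions_def)
    then show "T \<in> two_kind_of_pair ` mset_mset_pairs N L j m n"
      using AB TAB by (auto simp: mset_mset_pairs_def)
  qed
qed

section \<open>Negative arguments and the final count\<close>

lemma card_choose_two_le_sum:
  assumes "finite (D :: nat set)"
  shows "card D choose 2 \<le> \<Sum>D"
proof -
  \<comment> \<open>Any strict upper bound \<open>L\<close> of \<open>D\<close> serves: it makes
    \<open>D\<close> the staircase image of some multiset \<open>B\<close>, and
    \<open>sum_mset B\<close> is nonnegative.\<close>
  obtain L where "\<forall>x\<in>D. x < L"
    using assms finite_nat_set_iff_bounded by blast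
  then have "D \<in> {E. E \<subseteq> {..<L + card D} \<and> card E = card D}"
    by fastforce
  then have "D \<in> add_staircase ` bounded_msets L (card D)"
    using bij_betw_imp_surj_on[OF bij_betw_add_staircase[of L "card D"]] by simp
  then show ?thesis
    by (metis card_add_staircase imageE le_add2 sum_add_staircase)
qed

text \<open>In the range where no argument of \<open>pbar\<close> is negative, the two bijections
  compose. Otherwise \<open>D\<close> would need more than \<open>N + 1\<close> elements of
  \<open>{..N}\<close>, or a sum below the minimum \<open>m choose 2\<close>, so both sides are
  0.\<close>

lemma card_mset_set_pairs:
  "card (mset_set_pairs N j m n) = pbar 2 (int N) (int N + 1 - int m) (int j) (int m) (int n - int (m choose 2))"
proof (cases "m \<le> N + 1 \<and> m choose 2 \<le> n")
  case True
  define L n' where "L = N + 1 - m" and "n' = n - (m choose 2)"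
  have "card (mset_set_pairs N j m (n' + (m choose 2))) = card (two_kind_partitions 2 N L j m n')"
    using bij_betw_same_card[OF bij_betw_pairs] bij_betw_same_card[OF bij_betw_two_kind_of_pair] True
    by (metis L_def le_add_diff_inverse2)
  moreover have "int N + 1 - int m = int L" "int n - int (m choose 2) = int n'" "n' + (m choose 2) = n"
    using True by (auto simp: L_def n'_def)
  ultimately show ?thesis
    by (auto simp: pbar_def)
next
  case False
  have "mset_set_pairs N j m n = {}"
  proof (rule ccontr)
    assume "mset_set_pairs N j m n \<noteq> {}"
    then obtain A D where AD: "D \<subseteq> {..N}" "card D = m" "2 * sum_mset A + \<Sum>D = n"
      by (auto simp: mset_set_pairs_def)
    then have "m \<le> N + 1"
      using card_mono[of "{..N}" D] by simp
    moreover have "m choose 2 \<le> n"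
      using card_choose_two_le_sum[of D] AD finite_subset[OF AD(1)] by simp
    ultimately show False
      using False by simp
  qed
  then show ?thesis
    using False by (auto simp: pbar_def)
qed

theorem theorem3p1:
  fixes N k n :: nat
  shows "p N k n =
    (\<Sum>j = 0..k div 2.
       pbar 2 (int N) (int N + 1 - int k + 2 * int j) (int j) (int k - 2 * int j)
         (int n - int ((k - 2 * j) choose 2)))"
  unfolding p_eq_sum_mset_set_pairs
proof (rule sum.cong[OF refl])
  fix j assume "j \<in> {0..k div 2}"
  \<comment> \<open>The bound on \<open>j\<close> makes the subtraction on naturals agree with the
    one on integers.\<close>
  then have "int (k - 2 * j) = int k - 2 * int j"
    by auto
  then show "card (mset_set_pairs N j (k - 2 * j) n) =
      pbar 2 (int N) (int N + 1 - int k + 2 * int j) (int j) (int k - 2 * int j)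
        (int n - int ((k - 2 * j) choose 2))"
    unfolding card_mset_set_pairs by (simp add: algebra_simps)
qed

end
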